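(* Let $R$ be a commutative ring with unity such that $|\mathrm{Max}(R)|\geq 2$, and let $n$ be a positive integer. If $|\mathrm{Max}(R)|\geq n$, then the graph $\Gamma_2(R)\backslash J(R)$ has a clique of order $n$.
   Context: $\mathrm{Max}(R)$ denotes the set of all maximal (left) ideals of $R$, and $J(R)$ denotes the Jacobson radical of $R$. The comaximal graph $\Gamma(R)$ is the graph whose vertices are the elements of $R$, where two distinct vertices $a$ and $b$ are adjacent if and only if $Ra+Rb=R$. $\Gamma_2(R)$ is the subgraph of $\Gamma(R)$ induced on the non-unit elements of $R$, and $\Gamma_2(R)\backslash J(R)$ is the subgraph of $\Gamma(R)$ induced on the non-unit elements of $R$ that do not belong to $J(R)$. A clique of a graph $G$ is a complete subgraph of $G$; its order is its number of vertices. *)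

theory Defs
  imports
    "HOL-Library.Equipollence"
    "HOL-Algebra.Ideal"
    "Graph_Theory.Kuratowski"
begin

definition max_ideals :: "('a, 'm) ring_scheme \<Rightarrow> 'a set set"
  where "max_ideals R = {M. maximalideal M R}"

text \<open>
  The intersection is taken inside the carrier, so that it does not degenerate to the whole
  type when there are no maximal ideals.
\<close>

definition jacobson_radical :: "('a, 'm) ring_scheme \<Rightarrow> 'a set"
  where "jacobson_radical R = carrier R \<inter> \<Inter> (max_ideals R)"

text \<open>
  Undirected graphs are represented as symmetric digraphs: each edge between \<open>a\<close> and \<open>b\<close>
  gives the two arcs \<open>(a, b)\<close> and \<open>(b, a)\<close>. The principal ideal \<open>PIdl\<^bsub>R\<^esub> a\<close> is by definition
  the set of all products \<open>x \<otimes>\<^bsub>R\<^esub> a\<close>.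
\<close>

definition comaximal_graph :: "('a, 'm) ring_scheme \<Rightarrow> ('a, 'a \<times> 'a) pre_digraph"
  where "comaximal_graph R =
    \<lparr> verts = carrier R,
      arcs = {(a, b). a \<in> carrier R \<and> b \<in> carrier R \<and> a \<noteq> b \<and>
        (PIdl\<^bsub>R\<^esub> a) <+>\<^bsub>R\<^esub> (PIdl\<^bsub>R\<^esub> b) = carrier R},
      tail = fst,
      head = snd \<rparr>"

definition nonunit_nonradical_comaximal_graph ::
    "('a, 'm) ring_scheme \<Rightarrow> ('a, 'a \<times> 'a) pre_digraph"
  where "nonunit_nonradical_comaximal_graph R =
    comaximal_graph R \<restriction> (carrier R - Units R - jacobson_radical R)"

definition has_clique_of_order :: "('a, 'b) pre_digraph \<Rightarrow> nat \<Rightarrow> bool"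
  where "has_clique_of_order G n \<longleftrightarrow> (\<exists>H. subgraph H G \<and> complete_digraph n H)"

end

theory Submission
  imports Defs
begin

text \<open>
  Finitely many maximal ideals are processed one at a time. The elements to be avoided by the
  current ideal \<open>M\<close> (the elements already chosen, together with one element of \<open>N - M\<close> for every
  other ideal \<open>N\<close>) lie outside the prime ideal \<open>M\<close>, hence so does a common multiple \<open>p\<close> of them;
  writing \<open>1 = m + x p\<close> with \<open>m \<in> M\<close> gives an element of \<open>M\<close> comaximal to all of them.
  Comaximality to the elements of \<open>N - M\<close> keeps \<open>m\<close> out of the remaining ideals, so that it is
  neither in the radical nor an obstruction to the later choices.
\<close>

text \<open>The sum of two ideals is an ideal, so it is the whole ring as soon as it contains
  \<open>\<one>\<close>.\<close>

lemma (in cring) comaximal_iff: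
  assumes "a \<in> carrier R" "b \<in> carrier R"
  shows "PIdl a <+>\<^bsub>R\<^esub> PIdl b = carrier R \<longleftrightarrow>
    (\<exists>x \<in> carrier R. \<exists>y \<in> carrier R. \<one> = x \<otimes> a \<oplus> y \<otimes> b)"
proof -
  interpret I: ideal "PIdl a <+>\<^bsub>R\<^esub> PIdl b" R
    using assms by (intro add_ideals cgenideal_ideal)
  have "PIdl a <+>\<^bsub>R\<^esub> PIdl b = carrier R \<longleftrightarrow> \<one> \<in> PIdl a <+>\<^bsub>R\<^esub> PIdl b"
    using I.one_imp_carrier by auto
  also have "\<dots> \<longleftrightarrow> (\<exists>x \<in> carrier R. \<exists>y \<in> carrier R. \<one> = x \<otimes> a \<oplus> y \<otimes> b)"
    unfolding set_add_def' cgenideal_def by blast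
  finally show ?thesis .
qed

text \<open>Otherwise \<open>\<one>\<close> would be a combination of two members of the proper
  ideal \<open>N\<close>. The contrapositive is what keeps a newly chosen element out of the other
  maximal ideals.\<close>

lemma (in cring) comaximal_not_in_maximalideal:
  assumes "maximalideal N R" "a \<in> N" "b \<in> N"
  shows "PIdl a <+>\<^bsub>R\<^esub> PIdl b \<noteq> carrier R"
proof
  interpret N: maximalideal N R by fact
  assume "PIdl a <+>\<^bsub>R\<^esub> PIdl b = carrier R"
  then obtain x y where "x \<in> carrier R" "y \<in> carrier R" "\<one> = x \<otimes> a \<oplus> y \<otimes> b"
    using comaximal_iff[of a b] assms(2,3) N.Icarr by auto
  then have "\<one> \<in> N"
    using N.I_l_closed N.a_closed assms(2,3) by simp
  then show False
    using N.one_imp_carrier N.I_notcarr by simp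
qed

text \<open>\<open>M <+> PIdl p\<close> is an ideal containing \<open>M\<close> and also
  \<open>p\<close>, which is not in \<open>M\<close>, so maximality of \<open>M\<close> makes it the
  whole ring.\<close>

lemma (in cring) maximalideal_sum_one:
  assumes "maximalideal M R" "p \<in> carrier R - M"
  obtains m x where "m \<in> M" "x \<in> carrier R" "\<one> = m \<oplus> x \<otimes> p"
proof -
  interpret M: maximalideal M R by fact
  interpret J: ideal "M <+>\<^bsub>R\<^esub> PIdl p" R
    using assms(2) by (intro add_ideals cgenideal_ideal M.is_ideal) auto
  have "M \<subseteq> M <+>\<^bsub>R\<^esub> PIdl p"
  proof
    fix m assume "m \<in> M"
    moreover have "\<zero> \<in> PIdl p"
      using assms(2) additive_subgroup.zero_closed ideal.axioms(1) cgenideal_ideal by blast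
    ultimately have "m \<oplus> \<zero> \<in> M <+>\<^bsub>R\<^esub> PIdl p"
      unfolding set_add_def' by blast
    then show "m \<in> M <+>\<^bsub>R\<^esub> PIdl p"
      using \<open>m \<in> M\<close> M.Icarr by simp
  qed
  moreover have "p \<in> M <+>\<^bsub>R\<^esub> PIdl p"
  proof -
    have "\<zero> \<oplus> p \<in> M <+>\<^bsub>R\<^esub> PIdl p"
      unfolding set_add_def' using M.zero_closed cgenideal_self assms(2) by blast
    then show ?thesis using assms(2) by simp
  qed
  moreover have "M <+>\<^bsub>R\<^esub> PIdl p \<subseteq> carrier R"
    using J.Icarr by blast
  ultimately have "M <+>\<^bsub>R\<^esub> PIdl p = carrier R"
    using M.I_maximal[OF J.is_ideal] assms(2) by blast
  then have "\<one> \<in> M <+>\<^bsub>R\<^esub> PIdl p" by simp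
  then show thesis
    using that unfolding set_add_def' cgenideal_def by blast
qed

text \<open>The product of the elements of \<open>S\<close> is such a multiple, and primeness keeps
  it out of \<open>P\<close>; for empty \<open>S\<close> it is \<open>\<one>\<close>.\<close>

lemma (in cring) primeideal_common_multiple:
  assumes "primeideal P R" "finite S" "S \<subseteq> carrier R - P"
  shows "\<exists>p \<in> carrier R - P. \<forall>s \<in> S. p \<in> PIdl s"
  using assms(2,3)
proof (induction S)
  case empty
  interpret P: primeideal P R by fact
  show ?case
    using P.one_imp_carrier P.I_notcarr by auto
next
  case (insert s S)
  interpret P: primeideal P R by fact
  obtain p where p: "p \<in> carrier R - P" "\<forall>t \<in> S. p \<in> PIdl t"
    using insert by auto
  have s: "s \<in> carrier R - P" using insert.prems by simp
  have "s \<otimes> p \<in> carrier R - P"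
    using p s P.I_prime by blast
  moreover have "s \<otimes> p \<in> PIdl t" if "t \<in> S" for t
    using ideal.I_l_closed[OF cgenideal_ideal] p s that insert.prems by blast
  moreover have "s \<otimes> p \<in> PIdl s"
    using ideal.I_r_closed[OF cgenideal_ideal cgenideal_self] p s by blast
  ultimately show ?case by blast
qed

text \<open>Every \<open>s\<close> divides the common multiple \<open>p\<close>, so the single
  equation \<open>\<one> = m \<oplus> x \<otimes> p\<close> is a comaximality relation of
  \<open>m\<close> with all \<open>s\<close> at once.\<close>

lemma (in cring) maximalideal_comaximal_element:
  assumes "maximalideal M R" "finite S" "S \<subseteq> carrier R - M"
  obtains m where "m \<in> M" "\<And>s. s \<in> S \<Longrightarrow> PIdl m <+>\<^bsub>R\<^esub> PIdl s = carrier R"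
proof -
  interpret M: maximalideal M R by fact
  obtain p where p: "p \<in> carrier R - M" "\<forall>s \<in> S. p \<in> PIdl s"
    using primeideal_common_multiple[OF maximalideal_prime[OF assms(1)] assms(2,3)] by blast
  obtain m x where m: "m \<in> M" "x \<in> carrier R" "\<one> = m \<oplus> x \<otimes> p"
    using maximalideal_sum_one[OF assms(1) p(1)] .
  have "PIdl m <+>\<^bsub>R\<^esub> PIdl s = carrier R" if "s \<in> S" for s
  proof -
    have s: "s \<in> carrier R" using that assms(3) by blast
    have "p \<in> PIdl s" using p(2) that by blast
    then obtain y where y: "y \<in> carrier R" "p = y \<otimes> s"
      by (auto simp: cgenideal_def)
    have "\<one> = \<one> \<otimes> m \<oplus> (x \<otimes> y) \<otimes> s"
      using m(2) y(1) s M.Icarr[OF m(1)] by (subst m(3)) (simp add: y(2) m_assoc)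
    moreover have "m \<in> carrier R" using m(1) by (rule M.Icarr)
    ultimately show ?thesis
      using comaximal_iff[of m s] m(2) y(1) s by blast
  qed
  with m(1) that show thesis by blast
qed

lemma (in cring) pairwise_comaximal_system:
  assumes "finite \<M>" "\<M> \<subseteq> max_ideals R"
  shows "\<exists>a. (\<forall>M \<in> \<M>. a M \<in> M \<and> (\<forall>N \<in> \<M> - {M}. a M \<notin> N)) \<and>
    (\<forall>M \<in> \<M>. \<forall>N \<in> \<M>. M \<noteq> N \<longrightarrow> PIdl (a M) <+>\<^bsub>R\<^esub> PIdl (a N) = carrier R)"
proof -
  have max: "maximalideal M R" if "M \<in> \<M>" for M
    using that assms(2) by (auto simp: max_ideals_def)
  have carr: "x \<in> carrier R" if "x \<in> M" "M \<in> \<M>" for x M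
    using ideal.Icarr[OF maximalideal.axioms(1)[OF max]] that by blast
  \<comment> \<open>The induction enlarges \<open>\<F>\<close>, but avoidance is demanded for all of
    \<open>\<M>\<close>: an element chosen early must already lie outside the ideals still to be
    processed.\<close>
  have "\<exists>a. (\<forall>M \<in> \<F>. a M \<in> M \<and> (\<forall>N \<in> \<M> - {M}. a M \<notin> N)) \<and>
      (\<forall>M \<in> \<F>. \<forall>N \<in> \<F>. M \<noteq> N \<longrightarrow> PIdl (a M) <+>\<^bsub>R\<^esub> PIdl (a N) = carrier R)"
    if "finite \<F>" "\<F> \<subseteq> \<M>" for \<F>
    using that
  proof (induction \<F>)
    case empty
    show ?case by simp
  next
    case (insert M \<F>)
    have M: "M \<in> \<M>" and \<F>: "\<F> \<subseteq> \<M>" using insert.prems by auto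
    obtain a where a: "\<forall>K \<in> \<F>. a K \<in> K \<and> (\<forall>N \<in> \<M> - {K}. a K \<notin> N)"
      and comax: "\<forall>K \<in> \<F>. \<forall>N \<in> \<F>. K \<noteq> N \<longrightarrow> PIdl (a K) <+>\<^bsub>R\<^esub> PIdl (a N) = carrier R"
      using insert.IH[OF \<F>] by blast
    \<comment> \<open>Distinct maximal ideals are incomparable: \<open>N \<subseteq> M\<close> would
      contradict the maximality of \<open>N\<close>.\<close>
    have "\<exists>c. c \<in> N - M" if "N \<in> \<M> - {M}" for N
    proof (rule ccontr)
      assume "\<not> ?thesis"
      then have "N \<subseteq> M" by blast
      moreover have "M \<subseteq> carrier R" using carr M by blast
      moreover have "ideal M R" using max M maximalideal.axioms(1) by blast
      ultimately have "M = N \<or> M = carrier R"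
        using maximalideal.I_maximal[OF max] that by blast
      then show False
        using that maximalideal.I_notcarr[OF max[OF M]] by blast
    qed
    then obtain c where c: "\<And>N. N \<in> \<M> - {M} \<Longrightarrow> c N \<in> N - M" by metis
    let ?S = "a ` \<F> \<union> c ` (\<M> - {M})"
    have "finite ?S" using insert.hyps assms(1) by simp
    moreover have "?S \<subseteq> carrier R - M"
    proof -
      \<comment> \<open>Since \<open>M \<notin> \<F>\<close>, \<open>M\<close> is one of the ideals
        that \<open>a K\<close> avoids by the induction hypothesis.\<close>
      have "a K \<in> carrier R - M" if "K \<in> \<F>" for K
        using a that \<F> M carr insert.hyps(2) by blast
      moreover have "c N \<in> carrier R - M" if "N \<in> \<M> - {M}" for N
        using c[OF that] carr that by blast
      ultimately show ?thesis by blast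
    qed
    ultimately obtain m where m: "m \<in> M"
      "\<And>s. s \<in> ?S \<Longrightarrow> PIdl m <+>\<^bsub>R\<^esub> PIdl s = carrier R"
      using maximalideal_comaximal_element[OF max[OF M]] by metis
    \<comment> \<open>\<open>m\<close> is comaximal to \<open>c N\<close>, which lies in
      \<open>N\<close>, so the two cannot both be in \<open>N\<close>.\<close>
    have m_notin: "m \<notin> N" if "N \<in> \<M> - {M}" for N
      using comaximal_not_in_maximalideal[OF max, of N m "c N"] c[OF that] m(2) that by blast
    have m_comax: "PIdl m <+>\<^bsub>R\<^esub> PIdl (a K) = carrier R"
      "PIdl (a K) <+>\<^bsub>R\<^esub> PIdl m = carrier R" if "K \<in> \<F>" for K
    proof -
      show *: "PIdl m <+>\<^bsub>R\<^esub> PIdl (a K) = carrier R" using m(2) that by blast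
      have "a K \<in> carrier R" "m \<in> carrier R" using a that \<F> M m(1) carr by blast+
      then have "PIdl m \<subseteq> carrier R" "PIdl (a K) \<subseteq> carrier R"
        unfolding cgenideal_def by auto
      with * show "PIdl (a K) <+>\<^bsub>R\<^esub> PIdl m = carrier R" using set_add_comm by simp
    qed
    show ?case
      using a comax m(1) m_notin m_comax insert.hyps(2)
      by (intro exI[of _ "a(M := m)"]) auto
  qed
  from this[OF assms(1) subset_refl] show ?thesis .
qed

lemma (in cring) comaximal_clique:
  assumes "finite A" "A \<subseteq> carrier R - Units R - jacobson_radical R"
    and comax: "\<And>a b. a \<in> A \<Longrightarrow> b \<in> A \<Longrightarrow> a \<noteq> b \<Longrightarrow> PIdl a <+>\<^bsub>R\<^esub> PIdl b = carrier R"
  shows "has_clique_of_order (nonunit_nonradical_comaximal_graph R) (card A)"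
proof -
  let ?G = "nonunit_nonradical_comaximal_graph R"
  \<comment> \<open>All ordered pairs of distinct elements are arcs, so each edge occurs in both
    directions as in the ambient graph.\<close>
  let ?H = "\<lparr> verts = A, arcs = {(a, b). a \<in> A \<and> b \<in> A \<and> a \<noteq> b}, tail = fst, head = snd \<rparr>"
  have "wf_digraph ?G"
    by unfold_locales
      (auto simp: nonunit_nonradical_comaximal_graph_def comaximal_graph_def)
  moreover have H: "wf_digraph ?H"
    by unfold_locales auto
  ultimately have "subgraph ?H ?G"
    using assms(2) comax unfolding subgraph_def compatible_def
    by (auto simp: nonunit_nonradical_comaximal_graph_def comaximal_graph_def)
  moreover have ends: "arcs_ends ?H = {(a, b). a \<in> A \<and> b \<in> A \<and> a \<noteq> b}"
    by (force simp: arcs_ends_conv)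
  moreover have "finite (arcs ?H)"
    by (rule finite_subset[of _ "A \<times> A"]) (use assms(1) in auto)
  then have "graph ?H"
    using assms(1)
    by unfold_locales (auto simp: symmetric_def ends sym_def arc_to_ends_def)
  ultimately show ?thesis
    unfolding has_clique_of_order_def complete_digraph_def
    by (intro exI[of _ ?H] conjI) simp_all
qed

theorem theorem2:
  fixes R :: "('a, 'm) ring_scheme" and n :: nat
  assumes "cring R"
    and "{..<2::nat} \<lesssim> max_ideals R"
    and "n > 0"
    and "{..<n} \<lesssim> max_ideals R"
  shows "has_clique_of_order (nonunit_nonradical_comaximal_graph R) n"
proof -
  interpret cring R by fact
  \<comment> \<open>Even for \<open>n = 1\<close> a second maximal ideal is needed to keep the vertex out of the radical.\<close>
  have "{..<max 2 n} \<lesssim> max_ideals R"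
    using assms(2,4) by (auto simp: max_def)
  then obtain f where f: "inj_on f {..<max 2 n}" "f ` {..<max 2 n} \<subseteq> max_ideals R"
    unfolding lepoll_def by blast
  define \<M> where "\<M> = f ` {..<max 2 n}"
  have \<M>: "finite \<M>" "\<M> \<subseteq> max_ideals R" "card \<M> = max 2 n"
    using f by (auto simp: \<M>_def card_image)
  obtain a where a: "\<forall>M \<in> \<M>. a M \<in> M \<and> (\<forall>N \<in> \<M> - {M}. a M \<notin> N)"
    and comax: "\<forall>M \<in> \<M>. \<forall>N \<in> \<M>. M \<noteq> N \<longrightarrow> PIdl\<^bsub>R\<^esub> (a M) <+>\<^bsub>R\<^esub> PIdl\<^bsub>R\<^esub> (a N) = carrier R"
    using pairwise_comaximal_system[OF \<M>(1,2)] by blast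
  \<comment> \<open>The vertices come from only \<open>n\<close> of the ideals; the rest of
    \<open>\<M>\<close>, present only when \<open>n = 1\<close>, still serves to keep them out of
    the radical.\<close>
  obtain \<F> where \<F>: "\<F> \<subseteq> \<M>" "card \<F> = n" "finite \<F>"
    using obtain_subset_with_card_n[of n \<M>] \<M>(3) by auto
  \<comment> \<open>For \<open>M \<noteq> N\<close>, \<open>a M\<close> lies in \<open>M\<close>
    while \<open>a N\<close> does not.\<close>
  have "inj_on a \<F>"
    using a \<F>(1) by (intro inj_onI) (metis DiffI singletonD subsetD)
  then have card: "card (a ` \<F>) = n"
    using \<F>(2) by (simp add: card_image)
  have "a M \<in> carrier R - Units R - jacobson_radical R" if "M \<in> \<F>" for M
  proof -
    have M: "M \<in> \<M>" using that \<F>(1) by blast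
    then interpret M: maximalideal M R using \<M>(2) by (auto simp: max_ideals_def)
    have aM: "a M \<in> M" using a M by blast
    \<comment> \<open>A unit in \<open>M\<close> times its inverse would put \<open>\<one>\<close>
      into \<open>M\<close>.\<close>
    have "a M \<notin> Units R"
      using aM M.I_l_closed Units_inv_closed Units_l_inv M.one_imp_carrier M.I_notcarr by metis
    moreover have "\<M> \<noteq> {M}" using \<M>(3) by auto
    then obtain N where "N \<in> \<M> - {M}" using M by blast
    then have "a M \<notin> jacobson_radical R"
      using a M \<M>(2) by (auto simp: jacobson_radical_def)
    ultimately show ?thesis using aM M.Icarr by blast
  qed
  then have "a ` \<F> \<subseteq> carrier R - Units R - jacobson_radical R" by (rule image_subsetI)
  moreover have "PIdl\<^bsub>R\<^esub> x <+>\<^bsub>R\<^esub> PIdl\<^bsub>R\<^esub> y = carrier R"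
    if xy: "x \<in> a ` \<F>" "y \<in> a ` \<F>" "x \<noteq> y" for x y
  proof -
    obtain M N where "M \<in> \<F>" "N \<in> \<F>" "x = a M" "y = a N" using xy by blast
    moreover from this have "M \<noteq> N" using \<open>x \<noteq> y\<close> by blast
    ultimately show ?thesis using \<F>(1) comax by (simp add: subset_iff)
  qed
  ultimately show ?thesis
    using comaximal_clique[of "a ` \<F>"] \<F>(3) card by simp
qed

end
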